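(* Let $d\geq 1$ be an integer, let $r\geq 1$ be real, and set $p_r:=\frac{2r}{\log_2(2+2^r)}$. Then $$\|f*g\|_{\ell^r(\mathbb{Z}^d)}\leq \|f\|_{\ell^{p_r}(\mathbb{Z}^d)}\, \|g\|_{\ell^{p_r}(\mathbb{Z}^d)}$$ holds for all $f,g:\mathbb{Z}^d\to \mathbb{R}$ supported in $\{0,1\}^d$. Moreover, the exponent $p_r$ cannot be replaced by any larger real number; that is, for every real $p>p_r$ the inequality $\|f*g\|_{\ell^r(\mathbb{Z}^d)}\leq \|f\|_{\ell^{p}(\mathbb{Z}^d)} \|g\|_{\ell^{p}(\mathbb{Z}^d)}$ fails for some $f,g:\mathbb{Z}^d\to\mathbb{R}$ supported in $\{0,1\}^d$.
   Context: A function $f:\mathbb{Z}^d\to\mathbb{R}$ is supported in $\{0,1\}^d$ if $f(x)=0$ for all $x\notin\{0,1\}^d$. Convolution: $(f*g)(x)=\sum_{y\in\mathbb{Z}^d} f(y)g(x-y)$. Norms: $\|f\|_{\ell^p(\mathbb{Z}^d)}=\big(\sum_{x\in\mathbb{Z}^d}|f(x)|^p\big)^{1/p}$ for $0<p<\infty$. *)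

theory Defs
  imports "HOL-Analysis.Analysis"
begin

text \<open>
  The group \<open>\<int>\<^sup>d\<close> is the type \<open>int ^ 'd\<close> with \<open>'d\<close> an arbitrary finite (nonempty) index type,
  so that \<open>d = CARD('d) \<ge> 1\<close>.
\<close>

definition cube01 :: "(int ^ 'd) set" where
  "cube01 = {x. \<forall>i. x $ i \<in> {0, 1}}"

definition supported_in :: "('a \<Rightarrow> real) \<Rightarrow> 'a set \<Rightarrow> bool" where
  "supported_in f A \<longleftrightarrow> (\<forall>x. x \<notin> A \<longrightarrow> f x = 0)"

text \<open>
  As \<open>infsum\<close> is \<open>0\<close> on families that are not summable, the next two definitions have their usual
  meaning only where the sums converge. If \<open>f\<close> and \<open>g\<close> have finite support, then so does their
  convolution, and all these sums have finitely many nonzero terms.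
\<close>

definition convolution :: "(int ^ 'd \<Rightarrow> real) \<Rightarrow> (int ^ 'd \<Rightarrow> real) \<Rightarrow> int ^ 'd \<Rightarrow> real" where
  "convolution f g x = (\<Sum>\<^sub>\<infinity>y. f y * g (x - y))"

text \<open>Meant for \<open>0 < p < \<infinity>\<close>; zero values of \<open>f\<close> contribute nothing, since \<open>0 powr p = 0\<close>.\<close>

definition lp_norm :: "real \<Rightarrow> (int ^ 'd \<Rightarrow> real) \<Rightarrow> real" where
  "lp_norm p f = (\<Sum>\<^sub>\<infinity>x. \<bar>f x\<bar> powr p) powr (1 / p)"

definition crit_exponent :: "real \<Rightarrow> real" where
  "crit_exponent r = 2 * r / log 2 (2 + 2 powr r)"

end

theory Submission
  imports Defs
begin

text \<open>
  Write \<open>p\<close> for the critical exponent and \<open>q = 2 r / p = log 2 (2 + 2 powr r)\<close>; then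
  \<open>1 \<le> p \<le> 2\<close>, \<open>p \<le> r\<close> and \<open>q \<ge> 2\<close>.

  The inequality tensorizes. Splitting \<open>f\<close> and \<open>g\<close> along one coordinate as \<open>f0 + f1\<close> and
  \<open>g0 + g1\<close>, the convolution has the three layers \<open>f0 * g0\<close>, \<open>f0 * g1 + f1 * g0\<close> and
  \<open>f1 * g1\<close>. The Minkowski inequality in \<open>\<ell>\<^sup>r\<close> for the middle layer and the inductive bounds
  for the four products reduce the inductive step to the two-point inequality
  (\<open>two_point_inequality\<close>) for nonnegative reals, which is the case of dimension one:
  \<open>(ac)\<^sup>r + (ad + bc)\<^sup>r + (bd)\<^sup>r \<le> (a\<^sup>p + b\<^sup>p)\<^bsup>r/p\<^esup> (c\<^sup>p + d\<^sup>p)\<^bsup>r/p\<^esup>\<close>.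

  For positive entries, scaling and the substitution \<open>b/a = exp \<alpha>\<close>, \<open>d/c = exp \<gamma>\<close> turn the
  two-point inequality into
  \<open>2 cosh (q s) + (2 cosh (2 t / p))\<^sup>r \<le> (2 cosh (2 s) + 2 cosh (2 t))\<^bsup>q/2\<^esup>\<close>
  with \<open>s = p (\<alpha> + \<gamma>) / 4\<close> and \<open>t = p (\<alpha> - \<gamma>) / 4\<close>. The base on the right is
  \<open>(2 cosh s)\<^sup>2 + (2 cosh t)\<^sup>2 - 4\<close>, so convexity of \<open>z\<^bsup>q/2\<^esup>\<close> (\<open>powr_add_le_shift\<close>) separates
  the variables, the right-hand side being at least \<open>(2 cosh s)\<^sup>q + (2 cosh t)\<^sup>q - 2\<^sup>q\<close>.
  Since \<open>2\<^sup>q = 2 + 2\<^sup>r\<close>, what remains is the sum of two inequalities in one variable,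
  \<open>cosh_multiple_le_powr\<close> and \<open>cosh_multiple_powr_le\<close>, both equalities at \<open>0\<close>. On
  differentiation they follow from comparing \<open>sinh (\<theta> m)\<close> with
  \<open>sinh m (2 cosh m)\<^bsup>\<theta>-1\<^esup>\<close>: the two agree at \<open>\<theta> = 1\<close> and \<open>\<theta> = 2\<close>, the logarithm of the
  first is concave in \<open>\<theta>\<close> and that of the second is affine.

  The exponent is optimal already for the indicator of \<open>{0, e}\<close> with \<open>e\<close> a coordinate vector:
  its convolution square takes the values \<open>1, 2, 1\<close>, so it has norm
  \<open>(2 + 2\<^sup>r)\<^bsup>1/r\<^esup> = 2\<^bsup>2/p\<^esup>\<close>, and equality holds at the critical exponent.
\<close>

section \<open>Comparison of hyperbolic functions\<close>

lemma two_cosh_eq: "2 * cosh x = exp x + exp (- x)" for x :: real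
  by (simp add: cosh_field_def)

lemma concave_on_ln_sinh:
  fixes m :: real
  assumes "m > 0"
  shows "concave_on {0<..} (\<lambda>t. ln (sinh (t * m)))"
proof (rule f''_le0_imp_concave)
  show "convex {0::real<..}" by simp
next
  fix t :: real assume "t \<in> {0<..}"
  then have pos: "sinh (t * m) > 0" using assms by simp
  show "((\<lambda>t. ln (sinh (t * m))) has_real_derivative m * (cosh (t * m) / sinh (t * m))) (at t)"
    using pos by (auto intro!: derivative_eq_intros)
  define S where "S = sinh (t * m)"
  define C where "C = cosh (t * m)"
  have "C * C = S * S + 1"
    using cosh_square_eq[of "t * m"] unfolding S_def C_def by (simp only: power2_eq_square)
  then have "S * m * S - C * (C * m) = - m"
    by (simp only: mult.assoc[symmetric]) (simp add: algebra_simps)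
  then have "m * ((S * m * S - C * (C * m)) / (S * S)) = - (m\<^sup>2 / S\<^sup>2)"
    by (simp only: power2_eq_square) simp
  moreover have "((\<lambda>t. m * (cosh (t * m) / sinh (t * m))) has_real_derivative
      m * ((S * m * S - C * (C * m)) / (S * S))) (at t)"
    unfolding S_def C_def
    by (rule derivative_eq_intros refl pos[THEN less_imp_neq, symmetric] | simp)+
  ultimately show "((\<lambda>t. m * (cosh (t * m) / sinh (t * m))) has_real_derivative
      - (m\<^sup>2 / (sinh (t * m))\<^sup>2)) (at t)"
    unfolding S_def by simp
  show "- (m\<^sup>2 / (sinh (t * m))\<^sup>2) \<le> 0" by simp
qed

text \<open>
  Both sides agree at \<open>t = 1\<close> and at \<open>t = 2\<close> (the double angle formula), so concavity gives
  this bound between these points and the reverse one, \<open>sinh_le_powr\<close>, for \<open>t \<ge> 2\<close>.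
\<close>
lemma sinh_powr_le:
  fixes m t :: real
  assumes m: "m > 0" and t: "1 \<le> t" "t \<le> 2"
  shows "sinh m * (2 * cosh m) powr (t - 1) \<le> sinh (t * m)"
proof -
  have dbl: "ln (sinh (2 * m)) = ln (sinh m) + ln (2 * cosh m)"
    using m by (simp add: sinh_double ln_mult)
  have "ln (sinh m) + (t - 1) * ln (2 * cosh m)
      = (1 - (t - 1)) * ln (sinh (1 * m)) + (t - 1) * ln (sinh (2 * m))"
    unfolding dbl by (simp add: algebra_simps)
  also have "\<dots> \<le> ln (sinh (((1 - (t - 1)) *\<^sub>R 1 + (t - 1) *\<^sub>R 2) * m))"
    by (rule concave_onD[OF concave_on_ln_sinh[OF m]]) (use t in auto)
  also have "((1 - (t - 1)) *\<^sub>R 1 + (t - 1) *\<^sub>R 2 :: real) = t" by simp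
  finally have "exp (ln (sinh m) + (t - 1) * ln (2 * cosh m)) \<le> exp (ln (sinh (t * m)))"
    by simp
  then show ?thesis using m t by (simp add: exp_add powr_def)
qed

lemma sinh_le_powr:
  fixes m t :: real
  assumes m: "m > 0" and t: "2 \<le> t"
  shows "sinh (t * m) \<le> sinh m * (2 * cosh m) powr (t - 1)"
proof -
  \<comment> \<open>The point \<open>2\<close> is the convex combination \<open>(1 - l) \<cdot> 1 + l \<cdot> t\<close>.\<close>
  define l where "l = 1 / (t - 1)"
  have l: "0 \<le> l" "l \<le> 1" "(t - 1) * l = 1" using t by (auto simp: l_def)
  have eq: "((1 - l) *\<^sub>R 1 + l *\<^sub>R t :: real) = 2"
    using l(3) by (simp add: algebra_simps)
  have dbl: "ln (sinh (2 * m)) = ln (sinh m) + ln (2 * cosh m)"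
    using m by (simp add: sinh_double ln_mult)
  have "(1 - l) * ln (sinh (1 * m)) + l * ln (sinh (t * m))
      \<le> ln (sinh (((1 - l) *\<^sub>R 1 + l *\<^sub>R t) * m))"
    by (rule concave_onD[OF concave_on_ln_sinh[OF m]]) (use t l in auto)
  then have "l * ln (sinh (t * m)) \<le> l * ln (sinh m) + ln (2 * cosh m)"
    unfolding eq dbl by (simp add: algebra_simps)
  then have "(t - 1) * (l * ln (sinh (t * m))) \<le> (t - 1) * (l * ln (sinh m) + ln (2 * cosh m))"
    using t by (intro mult_left_mono) auto
  also have "\<dots> = ((t - 1) * l) * ln (sinh m) + (t - 1) * ln (2 * cosh m)"
    by (simp only: distrib_left mult.assoc)
  finally have "ln (sinh (t * m)) \<le> ln (sinh m) + (t - 1) * ln (2 * cosh m)"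
    unfolding mult.assoc[symmetric] l(3) by simp
  then have "exp (ln (sinh (t * m))) \<le> exp (ln (sinh m) + (t - 1) * ln (2 * cosh m))"
    by simp
  then show ?thesis using m t by (simp add: exp_add powr_def)
qed

lemma nondecreasing_if_deriv_diff:
  fixes F g h :: "real \<Rightarrow> real"
  assumes "a \<le> b"
    and deriv: "\<And>x. a \<le> x \<Longrightarrow> x \<le> b \<Longrightarrow> (F has_real_derivative g x - h x) (at x)"
    and le: "\<And>x. a \<le> x \<Longrightarrow> x \<le> b \<Longrightarrow> h x \<le> g x"
  shows "F a \<le> F b"
proof (rule DERIV_nonneg_imp_nondecreasing[OF \<open>a \<le> b\<close>])
  fix x assume x: "a \<le> x" "x \<le> b"
  show "\<exists>y. (F has_real_derivative y) (at x) \<and> 0 \<le> y"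
    using deriv[OF x] le[OF x] by (intro exI[of _ "g x - h x"]) simp
qed

lemma powr_superadditive:
  fixes x y s :: real
  assumes "0 \<le> x" "0 \<le> y" "1 \<le> s"
  shows "x powr s + y powr s \<le> (x + y) powr s"
proof -
  have split: "z powr s = z * z powr (s - 1)" if "0 \<le> z" for z :: real
    using that powr_add[of z 1 "s - 1"] by simp
  have "x powr s + y powr s = x * x powr (s - 1) + y * y powr (s - 1)"
    using assms split by simp
  also have "\<dots> \<le> x * (x + y) powr (s - 1) + y * (x + y) powr (s - 1)"
    using assms by (intro add_mono mult_left_mono powr_mono2) auto
  also have "\<dots> = (x + y) powr s"
    using assms split[of "x + y"] by (simp add: algebra_simps)
  finally show ?thesis .
qed

text \<open>
  Convexity of \<open>z powr s\<close>: the pair \<open>a, b\<close> has the same sum as the wider pair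
  \<open>c, a + b - c\<close>.
\<close>
lemma powr_add_le_shift:
  fixes a b c s :: real
  assumes "0 < c" "c \<le> a" "c \<le> b" "1 \<le> s"
  shows "a powr s + b powr s \<le> c powr s + (a + b - c) powr s"
proof -
  have "(c + b - c) powr s - c powr s \<le> (a + b - c) powr s - a powr s"
  proof (rule nondecreasing_if_deriv_diff[OF assms(2)])
    fix t assume t: "c \<le> t" "t \<le> a"
    show "((\<lambda>t. (t + b - c) powr s - t powr s) has_real_derivative
        s * (t + b - c) powr (s - 1) - s * t powr (s - 1)) (at t)"
      using t assms by (auto intro!: derivative_eq_intros)
    show "s * t powr (s - 1) \<le> s * (t + b - c) powr (s - 1)"
      using t assms by (intro mult_left_mono powr_mono2) auto
  qed
  then show ?thesis by simp
qed

text \<open>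
  The case \<open>x = y\<close> of the normalized two-point inequality below, with \<open>q = 2 * r / p\<close> and
  \<open>x powr p = exp (2 * s)\<close>.
\<close>
lemma cosh_multiple_le_powr:
  fixes q s :: real
  assumes q: "2 \<le> q"
  shows "2 * cosh (q * s) + 2 powr q - 2 \<le> (2 * cosh s) powr q"
proof -
  have *: "2 * cosh (q * s) + 2 powr q - 2 \<le> (2 * cosh s) powr q" if "0 \<le> s" for s :: real
  proof -
    have "(2 * cosh 0) powr q - 2 * cosh (q * 0) \<le> (2 * cosh s) powr q - 2 * cosh (q * s)"
    proof (rule nondecreasing_if_deriv_diff[OF that])
      fix t :: real assume t: "0 \<le> t" "t \<le> s"
      show "((\<lambda>t. (2 * cosh t) powr q - 2 * cosh (q * t)) has_real_derivative
        2 * q * (sinh t * (2 * cosh t) powr (q - 1)) - 2 * q * sinh (q * t)) (at t)"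
        by (auto intro!: derivative_eq_intros)
      show "2 * q * sinh (q * t) \<le> 2 * q * (sinh t * (2 * cosh t) powr (q - 1))"
        using sinh_le_powr[OF _ q, of t] t q
        by (cases "t = 0") (auto intro!: mult_left_mono)
    qed
    then show ?thesis by simp
  qed
  show ?thesis using *[of "\<bar>s\<bar>"] by (cases "0 \<le> s") simp_all
qed

lemma cosh_multiple_le:
  fixes k t :: real
  assumes "1 \<le> k"
  shows "2 * cosh (k * t) \<le> (2 * cosh t) powr k"
  using powr_superadditive[of "exp t" "exp (-t)" k] assms
  unfolding two_cosh_eq by (simp add: exp_powr_real mult.commute[of t])

text \<open>
  The derivative comparison behind \<open>cosh_multiple_powr_le\<close>. The exponent \<open>r\<close> enters only
  through \<open>r \<ge> 2 / k\<close>. For \<open>r = 2 / k\<close> the right-hand side is \<open>sinh (2 * t)\<close> and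
  \<open>sinh_powr_le\<close> applies with \<open>m = k * t\<close>; a larger \<open>r\<close> only favours the right-hand side,
  because \<open>2 * cosh (k * t) \<le> (2 * cosh t) powr k\<close>.
\<close>
lemma sinh_multiple_mult_powr_le:
  fixes k r t :: real
  assumes k: "1 \<le> k" "k \<le> 2" and kr: "2 \<le> k * r" and t: "0 \<le> t"
  shows "sinh (k * t) * (2 * cosh (k * t)) powr (r - 1) \<le> sinh t * (2 * cosh t) powr (k * r - 1)"
proof (cases "t = 0")
  case False
  define m where "m = k * t"
  have m: "m > 0" using False t k by (simp add: m_def)
  have "sinh m * (2 * cosh m) powr (2 / k - 1) \<le> sinh ((2 / k) * m)"
    using m k by (intro sinh_powr_le) (auto simp: field_simps)
  also have "(2 / k) * m = 2 * t" using k by (simp add: m_def)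
  finally have 1: "sinh m * (2 * cosh m) powr (2 / k - 1) \<le> sinh (2 * t)" .
  have "(2 * cosh m) powr (r - 2 / k) \<le> ((2 * cosh t) powr k) powr (r - 2 / k)"
    unfolding m_def using k kr
    by (intro powr_mono2 cosh_multiple_le) (auto simp: field_simps)
  also have "\<dots> = (2 * cosh t) powr (k * r - 2)"
    using k by (simp add: powr_powr algebra_simps)
  finally have 2: "(2 * cosh m) powr (r - 2 / k) \<le> (2 * cosh t) powr (k * r - 2)" .
  have "sinh m * (2 * cosh m) powr (r - 1)
      = (sinh m * (2 * cosh m) powr (2 / k - 1)) * (2 * cosh m) powr (r - 2 / k)"
    by (simp add: mult.assoc flip: powr_add)
  also have "\<dots> \<le> sinh (2 * t) * (2 * cosh t) powr (k * r - 2)"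
    using 1 2 t by (intro mult_mono) auto
  also have "\<dots> = sinh t * ((2 * cosh t) powr 1 * (2 * cosh t) powr (k * r - 2))"
    by (simp add: sinh_double)
  also have "\<dots> = sinh t * (2 * cosh t) powr (k * r - 1)"
    unfolding powr_add[symmetric] by simp
  finally show ?thesis unfolding m_def .
qed auto

text \<open>
  The counterpart of \<open>cosh_multiple_le_powr\<close> for \<open>x * y = 1\<close> in the normalized two-point
  inequality, with \<open>k = 2 / p\<close> and \<open>x = exp (k * t)\<close>.
\<close>
lemma cosh_multiple_powr_le:
  fixes k r t :: real
  assumes k: "1 \<le> k" "k \<le> 2" and kr: "2 \<le> k * r"
  shows "(2 * cosh (k * t)) powr r + 2 powr (k * r) - 2 powr r \<le> (2 * cosh t) powr (k * r)"
proof -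
  have r: "0 < r" using k kr by (smt (verit) mult_nonneg_nonpos)
  have *: "(2 * cosh (k * t)) powr r + 2 powr (k * r) - 2 powr r \<le> (2 * cosh t) powr (k * r)"
    if "0 \<le> t" for t :: real
  proof -
    let ?F = "\<lambda>t. (2 * cosh t) powr (k * r) - (2 * cosh (k * t)) powr r"
    have "?F 0 \<le> ?F t"
    proof (rule nondecreasing_if_deriv_diff[OF that])
      fix u :: real assume u: "0 \<le> u" "u \<le> t"
      show "(?F has_real_derivative
        (2 * k * r) * (sinh u * (2 * cosh u) powr (k * r - 1))
        - (2 * k * r) * (sinh (k * u) * (2 * cosh (k * u)) powr (r - 1))) (at u)"
        by (auto intro!: derivative_eq_intros)
      show "(2 * k * r) * (sinh (k * u) * (2 * cosh (k * u)) powr (r - 1))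
          \<le> (2 * k * r) * (sinh u * (2 * cosh u) powr (k * r - 1))"
        using sinh_multiple_mult_powr_le[OF k kr u(1)] k r by (intro mult_left_mono) auto
    qed
    then show ?thesis by simp
  qed
  show ?thesis using *[of "\<bar>t\<bar>"] by (cases "0 \<le> t") simp_all
qed

section \<open>The two-point inequality\<close>

lemma crit_exponent_bounds:
  fixes r :: real
  assumes "1 \<le> r"
  shows "1 \<le> crit_exponent r" "crit_exponent r \<le> 2" "crit_exponent r \<le> r"
    and "2 powr (2 * r / crit_exponent r) = 2 + 2 powr r"
proof -
  let ?y = "2 powr r :: real"
  define L where "L = log 2 (2 + ?y)"
  have y: "2 \<le> ?y" using powr_mono[of 1 r 2] assms by simp
  have L: "2 \<le> L" "r \<le> L" "L \<le> 2 * r"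
  proof -
    have "log 2 4 \<le> L" "log 2 ?y \<le> L" unfolding L_def using y by (subst log_le_cancel_iff; simp)+
    moreover have "log 2 4 = (2::real)" using log_pow_cancel[of 2 2] by simp
    ultimately show "2 \<le> L" "r \<le> L" by simp_all
    \<comment> \<open>\<open>L \<le> 2 * r\<close> amounts to \<open>?y\<^sup>2 - ?y - 2 \<ge> 0\<close>.\<close>
    have "0 \<le> (?y - 2) * (?y + 1)" using y by simp
    then have "2 + ?y \<le> ?y * ?y" by (simp add: algebra_simps)
    also have "\<dots> = 2 powr (2 * r)" by (simp flip: powr_add)
    finally have "L \<le> log 2 (2 powr (2 * r))" unfolding L_def using y by (subst log_le_cancel_iff) auto
    then show "L \<le> 2 * r" by simp
  qed
  have p: "crit_exponent r = 2 * r / L" by (simp add: crit_exponent_def L_def)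
  show "1 \<le> crit_exponent r" "crit_exponent r \<le> 2" "crit_exponent r \<le> r"
    unfolding p using L assms by (auto simp: field_simps)
  have "2 * r / crit_exponent r = L" unfolding p using L assms by simp
  then show "2 powr (2 * r / crit_exponent r) = 2 + 2 powr r"
    using y by (simp add: L_def)
qed

lemma cosh_two_point:
  fixes r s t :: real
  assumes r: "1 \<le> r"
  defines "p \<equiv> crit_exponent r"
  shows "2 * cosh (2 * r / p * s) + (2 * cosh (2 / p * t)) powr r
    \<le> (2 * cosh (2 * s) + 2 * cosh (2 * t)) powr (r / p)"
proof -
  define q where "q = 2 * r / p"
  note b = crit_exponent_bounds[OF r, folded p_def]
  have q: "2 \<le> q" "2 / p * r = q" "2 powr q = 2 + 2 powr r"
    using b by (auto simp: q_def field_simps)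
  have sq: "((2 * cosh u)\<^sup>2) powr (r / p) = (2 * cosh u) powr q" for u
    using powr_powr[of "2 * cosh u" 2 "r / p"] by (simp add: q_def powr_numeral)
  have ge4: "4 \<le> (2 * cosh u)\<^sup>2" for u :: real
    using power_mono[OF cosh_real_ge_1[of u], of 2] by (simp add: power_mult_distrib)
  have four: "4 powr (r / p) = 2 powr q"
    using sq[of 0] by simp
  have "2 * cosh (q * s) + (2 * cosh (2 / p * t)) powr r
      \<le> (2 * cosh s) powr q + (2 * cosh t) powr q - 2 powr q"
    using cosh_multiple_le_powr[OF q(1), of s] cosh_multiple_powr_le[of "2 / p" r t] b q
    by (simp add: field_simps)
  also have "\<dots> \<le> ((2 * cosh s)\<^sup>2 + (2 * cosh t)\<^sup>2 - 4) powr (r / p)"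
    using powr_add_le_shift[of 4 "(2 * cosh s)\<^sup>2" "(2 * cosh t)\<^sup>2" "r / p"] ge4 b
    unfolding sq four by simp
  also have "(2 * cosh s)\<^sup>2 + (2 * cosh t)\<^sup>2 - 4 = 2 * cosh (2 * s) + 2 * cosh (2 * t)"
    by (simp add: cosh_double_cosh power_mult_distrib)
  finally show ?thesis unfolding q_def .
qed

lemma exp_sum_eq_cosh: "exp a + exp b = exp ((a + b) / 2) * (2 * cosh ((a - b) / 2))" for a b :: real
proof -
  have "(a + b) / 2 + (a - b) / 2 = a" "(a + b) / 2 - (a - b) / 2 = b"
    by (simp_all add: field_simps)
  then show ?thesis
    by (simp add: two_cosh_eq distrib_left flip: exp_add)
qed

lemma two_point_normalized:
  fixes x y r :: real
  assumes r: "1 \<le> r" and xy: "0 < x" "0 < y"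
  defines "p \<equiv> crit_exponent r"
  shows "1 + (x + y) powr r + (x * y) powr r
    \<le> (1 + x powr p) powr (r / p) * (1 + y powr p) powr (r / p)"
proof -
  note b = crit_exponent_bounds[OF r, folded p_def]
  define a where "a = ln x"
  define c where "c = ln y"
  have x: "x = exp a" and y: "y = exp c" using xy by (auto simp: a_def c_def)
  define s where "s = p * (a + c) / 4"
  define t where "t = p * (a - c) / 4"
  have st: "2 * r / p * s = r * (a + c) / 2" "2 / p * t = (a - c) / 2"
    using b by (simp_all add: s_def t_def)
  have "1 + (x * y) powr r = exp (r * (a + c)) + exp 0"
    by (simp add: x y exp_powr_real mult.commute[of r] flip: exp_add)
  then have e1: "1 + (x * y) powr r = exp (r * (a + c) / 2) * (2 * cosh (2 * r / p * s))"
    unfolding st exp_sum_eq_cosh by simp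
  have e2: "(x + y) powr r = exp (r * (a + c) / 2) * (2 * cosh (2 / p * t)) powr r"
    unfolding st x y exp_sum_eq_cosh[of a c] powr_mult exp_powr_real by simp
  have "(1 + x powr p) * (1 + y powr p)
      = (exp (p * (a + c)) + exp 0) + (exp (p * a) + exp (p * c))"
    by (simp add: x y exp_powr_real algebra_simps flip: exp_add)
  also have "\<dots> = exp (p * (a + c) / 2) * (2 * cosh (2 * s) + 2 * cosh (2 * t))"
  proof -
    have "p * (a + c) / 2 = 2 * s" "(p * a + p * c) / 2 = 2 * s" "(p * a - p * c) / 2 = 2 * t"
      by (simp_all add: s_def t_def field_simps)
    then show ?thesis unfolding exp_sum_eq_cosh by (simp add: distrib_left)
  qed
  finally have "((1 + x powr p) * (1 + y powr p)) powr (r / p)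
      = exp (p * (a + c) / 2) powr (r / p) * (2 * cosh (2 * s) + 2 * cosh (2 * t)) powr (r / p)"
    by (simp add: powr_mult)
  also have "exp (p * (a + c) / 2) powr (r / p) = exp (r * (a + c) / 2)"
    using b by (simp add: exp_powr_real field_simps)
  finally have e3: "(1 + x powr p) powr (r / p) * (1 + y powr p) powr (r / p)
      = exp (r * (a + c) / 2) * (2 * cosh (2 * s) + 2 * cosh (2 * t)) powr (r / p)"
    by (simp add: powr_mult)
  have "1 + (x + y) powr r + (x * y) powr r
      = exp (r * (a + c) / 2) * (2 * cosh (2 * r / p * s) + (2 * cosh (2 / p * t)) powr r)"
    using e1 e2 by (simp add: algebra_simps)
  also have "\<dots> \<le> exp (r * (a + c) / 2) * (2 * cosh (2 * s) + 2 * cosh (2 * t)) powr (r / p)"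
    using cosh_two_point[OF r, of s t] unfolding p_def by (intro mult_left_mono) auto
  finally show ?thesis unfolding e3 .
qed

lemma powr_add_le_powr_sum:
  fixes c d p r :: real
  assumes "0 \<le> c" "0 \<le> d" "0 < p" "p \<le> r"
  shows "c powr r + d powr r \<le> (c powr p + d powr p) powr (r / p)"
  using powr_superadditive[of "c powr p" "d powr p" "r / p"] assms
  by (simp add: powr_powr)

text \<open>
  If an entry vanishes, the claim is superadditivity of \<open>z powr (r / p)\<close>; otherwise it scales
  to the normalized form \<open>a = c = 1\<close>.
\<close>
lemma two_point_inequality:
  fixes a b c d r :: real
  assumes r: "1 \<le> r" and nn: "0 \<le> a" "0 \<le> b" "0 \<le> c" "0 \<le> d"
  defines "p \<equiv> crit_exponent r"
  shows "(a * c) powr r + (a * d + b * c) powr r + (b * d) powr r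
    \<le> (a powr p + b powr p) powr (r / p) * (c powr p + d powr p) powr (r / p)"
proof -
  note bd = crit_exponent_bounds[OF r, folded p_def]
  have p: "0 < p" "p \<le> r" using bd by auto
  have r0: "r \<noteq> 0" "p \<noteq> 0" using r p by auto
  have edge: "(u * z) powr r + (u * w) powr r \<le> (u powr p) powr (r / p) * (z powr p + w powr p) powr (r / p)"
    if "0 \<le> u" "0 \<le> z" "0 \<le> w" for u z w :: real
    using mult_left_mono[OF powr_add_le_powr_sum[OF that(2,3) p], of "u powr r"] that r0
    by (simp add: powr_powr powr_mult distrib_left)
  consider "a = 0" | "b = 0" | "c = 0" | "d = 0" | "0 < a" "0 < b" "0 < c" "0 < d"
    using nn by linarith
  then show ?thesis
  proof cases
    case 1 then show ?thesis using edge[of b c d] nn r0 by simp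
  next
    case 2 then show ?thesis using edge[of a c d] nn r0 by simp
  next
    case 3 then show ?thesis using edge[of d a b] nn r0 by (simp add: mult.commute)
  next
    case 4 then show ?thesis using edge[of c a b] nn r0 by (simp add: mult.commute)
  next
    case 5
    let ?x = "b / a" and ?y = "d / c"
    have scale: "(u powr p + v powr p) powr (r / p) = u powr r * (1 + (v / u) powr p) powr (r / p)"
      if "0 < u" "0 < v" for u v :: real
    proof -
      have "u powr p + v powr p = u powr p * (1 + (v / u) powr p)"
        using that by (simp add: powr_divide distrib_left)
      then show ?thesis using that r0 by (simp add: powr_mult powr_powr)
    qed
    have "a * d + b * c = (a * c) * (?x + ?y)" "b * d = (a * c) * (?x * ?y)"
      using 5 by (simp_all add: field_simps)
    then have "(a * d + b * c) powr r = (a * c) powr r * (?x + ?y) powr r"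
      and "(b * d) powr r = (a * c) powr r * (?x * ?y) powr r"
      using 5 by (simp_all only: powr_mult)
    then have "(a * c) powr r + (a * d + b * c) powr r + (b * d) powr r
        = (a * c) powr r * (1 + (?x + ?y) powr r + (?x * ?y) powr r)"
      by (simp only: distrib_left mult_1_right)
    also have "\<dots> \<le> (a * c) powr r * ((1 + ?x powr p) powr (r / p) * (1 + ?y powr p) powr (r / p))"
      using two_point_normalized[OF r, of ?x ?y] 5 unfolding p_def by (intro mult_left_mono) auto
    also have "\<dots> = (a powr p + b powr p) powr (r / p) * (c powr p + d powr p) powr (r / p)"
      using 5 by (simp add: scale powr_mult)
    finally show ?thesis .
  qed
qed

section \<open>Norms and convolutions of finitely supported functions\<close>

lemma powr_convex_nonneg:
  fixes l x y r :: real
  assumes "0 \<le> l" "l \<le> 1" "0 \<le> x" "0 \<le> y" "1 \<le> r"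
  shows "((1 - l) * x + l * y) powr r \<le> (1 - l) * x powr r + l * y powr r"
proof -
  have shrink: "c powr r \<le> c" if "0 \<le> c" "c \<le> 1" for c :: real
    using powr_mono'[of 1 r c] that assms by simp
  consider "x = 0" | "y = 0" | "0 < x" "0 < y" using assms by linarith
  then show ?thesis
  proof cases
    case 1
    then show ?thesis
      using assms mult_right_mono[OF shrink[of l], of "y powr r"] by (simp add: powr_mult)
  next
    case 2
    then show ?thesis
      using assms mult_right_mono[OF shrink[of "1 - l"], of "x powr r"] by (simp add: powr_mult)
  next
    case 3
    then show ?thesis
      using convex_onD[OF powr_convex[OF \<open>1 \<le> r\<close>], of l x y] assms by simp
  qed
qed

lemma Minkowski_sum_powr:
  fixes u v :: "'a \<Rightarrow> real"
  assumes "finite A" "1 \<le> r" "0 \<le> U" "0 \<le> V"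
    and U: "(\<Sum>x\<in>A. \<bar>u x\<bar> powr r) = U powr r"
    and V: "(\<Sum>x\<in>A. \<bar>v x\<bar> powr r) = V powr r"
  shows "(\<Sum>x\<in>A. \<bar>u x + v x\<bar> powr r) \<le> (U + V) powr r"
proof -
  have zero: "\<forall>x\<in>A. w x = 0" if "(\<Sum>x\<in>A. \<bar>w x\<bar> powr r) = 0" for w :: "'a \<Rightarrow> real"
    using that assms(1) by (simp add: sum_nonneg_eq_0_iff)
  consider "U = 0" | "V = 0" | "0 < U" "0 < V" using assms by linarith
  then show ?thesis
  proof cases
    case 1
    then show ?thesis using zero[of u] U V by simp
  next
    case 2
    then show ?thesis using zero[of v] U V by simp
  next
    case 3
    define l where "l = V / (U + V)"
    have l: "0 \<le> l" "l \<le> 1" "1 - l = U / (U + V)"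
      using 3 by (auto simp: l_def field_simps)
    have "\<bar>u x + v x\<bar> powr r \<le> (U + V) powr r
        * ((1 - l) * (\<bar>u x\<bar> powr r / U powr r) + l * (\<bar>v x\<bar> powr r / V powr r))" for x
    proof -
      have "\<bar>u x + v x\<bar> powr r \<le> (\<bar>u x\<bar> + \<bar>v x\<bar>) powr r"
        using assms by (intro powr_mono2) auto
      also have "\<bar>u x\<bar> + \<bar>v x\<bar> = (U + V) * ((1 - l) * (\<bar>u x\<bar> / U) + l * (\<bar>v x\<bar> / V))"
        using 3 unfolding l(3) unfolding l_def by (simp add: distrib_left)
      also have "\<dots> powr r = (U + V) powr r * ((1 - l) * (\<bar>u x\<bar> / U) + l * (\<bar>v x\<bar> / V)) powr r"
        by (rule powr_mult)
      also have "\<dots> \<le> (U + V) powr r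
          * ((1 - l) * (\<bar>u x\<bar> / U) powr r + l * (\<bar>v x\<bar> / V) powr r)"
        using 3 l assms by (intro mult_left_mono powr_convex_nonneg) auto
      finally show ?thesis using 3 by (simp add: powr_divide)
    qed
    then have "(\<Sum>x\<in>A. \<bar>u x + v x\<bar> powr r) \<le> (\<Sum>x\<in>A. (U + V) powr r
        * ((1 - l) * (\<bar>u x\<bar> powr r / U powr r) + l * (\<bar>v x\<bar> powr r / V powr r)))"
      by (rule sum_mono)
    also have "\<dots> = (U + V) powr r * ((1 - l) * ((\<Sum>x\<in>A. \<bar>u x\<bar> powr r) / U powr r)
        + l * ((\<Sum>x\<in>A. \<bar>v x\<bar> powr r) / V powr r))"
      by (simp only: sum_distrib_left[symmetric] sum.distrib sum_divide_distrib[symmetric])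
    also have "\<dots> = (U + V) powr r" using 3 by (simp add: U V)
    finally show ?thesis .
  qed
qed

lemma lp_norm_nonneg: "0 \<le> lp_norm p f"
  by (simp add: lp_norm_def)

lemma lp_norm_powr_eq_sum:
  assumes "finite A" "supported_in f A" "0 < p"
  shows "lp_norm p f powr p = (\<Sum>x\<in>A. \<bar>f x\<bar> powr p)"
proof -
  have "(\<Sum>\<^sub>\<infinity>x. \<bar>f x\<bar> powr p) = (\<Sum>\<^sub>\<infinity>x\<in>A. \<bar>f x\<bar> powr p)"
    using assms(2) by (intro infsum_cong_neutral) (auto simp: supported_in_def)
  also have "\<dots> = (\<Sum>x\<in>A. \<bar>f x\<bar> powr p)"
    using assms(1) by simp
  finally show ?thesis using assms(3) by (simp add: lp_norm_def powr_powr sum_nonneg)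
qed

lemma convolution_eq_sum:
  assumes "finite A" "supported_in f A"
  shows "convolution f g x = (\<Sum>y\<in>A. f y * g (x - y))"
proof -
  have "convolution f g x = (\<Sum>\<^sub>\<infinity>y\<in>A. f y * g (x - y))"
    unfolding convolution_def using assms(2)
    by (intro infsum_cong_neutral) (auto simp: supported_in_def)
  then show ?thesis using assms(1) by simp
qed

lemma supported_in_convolution:
  assumes "supported_in f A" "supported_in g B"
  shows "supported_in (convolution f g) ((\<lambda>(x, y). x + y) ` (A \<times> B))"
  unfolding supported_in_def
proof (intro allI impI)
  fix x assume x: "x \<notin> (\<lambda>(x, y). x + y) ` (A \<times> B)"
  have "f y * g (x - y) = 0" for y
  proof (cases "y \<in> A \<and> x - y \<in> B")
    case True
    then have "x \<in> (\<lambda>(x, y). x + y) ` (A \<times> B)" by (intro image_eqI[of _ _ "(y, x - y)"]) auto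
    then show ?thesis using x by blast
  next
    case False
    then show ?thesis using assms by (auto simp: supported_in_def)
  qed
  then show "convolution f g x = 0" by (simp only: convolution_def infsum_0_simp)
qed

section \<open>Tensorization\<close>

text \<open>
  The points of \<open>a + {0, 1}\<^sup>d\<close> that agree with \<open>a\<close> in the coordinates outside \<open>S\<close>. With an
  arbitrary corner, both layers of a box along one coordinate are boxes again, so the induction
  over \<open>S\<close> needs no translations.
\<close>
definition unit_box :: "int ^ 'd \<Rightarrow> 'd set \<Rightarrow> (int ^ 'd) set" where
  "unit_box a S = {x. \<forall>i. x $ i = a $ i \<or> (i \<in> S \<and> x $ i = a $ i + 1)}"

lemma unit_box_empty: "unit_box a {} = {a}"
  by (auto simp: unit_box_def vec_eq_iff)

lemma unit_box_insert:
  assumes "j \<notin> S"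
  shows "{x \<in> unit_box a (insert j S). x $ j = a $ j} = unit_box a S"
    and "{x \<in> unit_box a (insert j S). x $ j = a $ j + 1} = unit_box (a + axis j 1) S"
  using assms by (auto simp: unit_box_def axis_def split: if_splits)

lemma unit_box_insert_cases: "x \<in> unit_box a (insert j S) \<Longrightarrow> x $ j = a $ j \<or> x $ j = a $ j + 1"
  unfolding unit_box_def by blast

lemma finite_unit_box:
  fixes S :: "('d::finite) set"
  shows "finite (unit_box a S)"
proof -
  have "finite S" by simp
  then show ?thesis
  proof (induction S arbitrary: a)
    case empty
    show ?case by (simp add: unit_box_empty)
  next
    case (insert j S)
    have "unit_box a (insert j S) \<subseteq> unit_box a S \<union> unit_box (a + axis j 1) S"
      using unit_box_insert[OF insert.hyps(2), of a] unit_box_insert_cases by blast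
    then show ?case using insert.IH by (meson finite_UnI finite_subset)
  qed
qed

lemma cube01_eq_unit_box: "cube01 = unit_box 0 UNIV"
  by (auto simp: cube01_def unit_box_def)

lemma convolution_lp_norm_le_unit_box:
  fixes f g :: "int ^ 'd \<Rightarrow> real"
  assumes r: "1 \<le> r" and "supported_in f (unit_box a S)" "supported_in g (unit_box b S)"
  shows "lp_norm r (convolution f g) \<le> lp_norm (crit_exponent r) f * lp_norm (crit_exponent r) g"
proof -
  define p where "p = crit_exponent r"
  note pb = crit_exponent_bounds[OF r, folded p_def]
  have p0: "0 < p" and r0: "0 < r" using pb r by auto
  have "finite S" by simp
  then have "lp_norm r (convolution f g) \<le> lp_norm p f * lp_norm p g"
    using assms(2,3)
  proof (induction S arbitrary: a b f g)
    case empty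
    have f: "supported_in f {a}" and g: "supported_in g {b}"
      using empty by (simp_all add: unit_box_empty)
    have fg: "supported_in (convolution f g) {a + b}"
      using supported_in_convolution[OF f g] by simp
    have single: "lp_norm s h = \<bar>h c\<bar>" if "supported_in h {c}" "0 < s" for s h and c :: "int ^ 'd"
    proof -
      have "lp_norm s h powr s = \<bar>h c\<bar> powr s"
        using lp_norm_powr_eq_sum[OF _ that] by simp
      then show ?thesis using that(2) lp_norm_nonneg[of s h] by
        (metis abs_ge_zero powr_powr powr_one mult.commute nonzero_divide_eq_eq less_irrefl)
    qed
    have "convolution f g (a + b) = f a * g b"
      using convolution_eq_sum[OF _ f] by simp
    then show ?case
      using single[OF f p0] single[OF g p0] single[OF fg r0] by (simp add: abs_mult)
  next
    case (insert j S)
    define f0 where "f0 = (\<lambda>x. if x $ j = a $ j then f x else 0)"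
    define f1 where "f1 = (\<lambda>x. if x $ j = a $ j + 1 then f x else 0)"
    define g0 where "g0 = (\<lambda>x. if x $ j = b $ j then g x else 0)"
    define g1 where "g1 = (\<lambda>x. if x $ j = b $ j + 1 then g x else 0)"
    note defs = f0_def f1_def g0_def g1_def
    have f_eq: "f x = f0 x + f1 x" and g_eq: "g x = g0 x + g1 x" for x
      using insert.prems unit_box_insert_cases unfolding defs supported_in_def
      by (fastforce, fastforce)
    have sf0: "supported_in f0 (unit_box a S)" and sf1: "supported_in f1 (unit_box (a + axis j 1) S)"
      using insert.prems(1) unfolding defs unit_box_insert[OF insert.hyps(2), of a, symmetric]
      by (auto simp: supported_in_def)
    have sg0: "supported_in g0 (unit_box b S)" and sg1: "supported_in g1 (unit_box (b + axis j 1) S)"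
      using insert.prems(2) unfolding defs unit_box_insert[OF insert.hyps(2), of b, symmetric]
      by (auto simp: supported_in_def)
    \<comment> \<open>The four products live in the layers \<open>a $ j + b $ j + i\<close> with \<open>i = 0, 1, 1, 2\<close>.\<close>
    define h0 where "h0 = convolution f0 g0"
    define h01 where "h01 = convolution f0 g1"
    define h10 where "h10 = convolution f1 g0"
    define h2 where "h2 = convolution f1 g1"
    note hdefs = h0_def h01_def h10_def h2_def
    have layer: "supported_in u {x. x $ j = c} \<Longrightarrow> supported_in v {x. x $ j = d}
        \<Longrightarrow> x $ j \<noteq> c + d \<Longrightarrow> convolution u v x = 0" for u v c d x
      using supported_in_convolution[of u "{x. x $ j = c}" v "{x. x $ j = d}"]
      by (force simp: supported_in_def)
    have lf: "supported_in f0 {x. x $ j = a $ j}" "supported_in f1 {x. x $ j = a $ j + 1}"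
      "supported_in g0 {x. x $ j = b $ j}" "supported_in g1 {x. x $ j = b $ j + 1}"
      by (auto simp: defs supported_in_def)
    have lh: "x $ j \<noteq> a $ j + b $ j \<Longrightarrow> h0 x = 0"
      "x $ j \<noteq> a $ j + b $ j + 1 \<Longrightarrow> h01 x + h10 x = 0"
      "x $ j \<noteq> a $ j + b $ j + 2 \<Longrightarrow> h2 x = 0" for x
      using layer[OF lf(1,3), of x] layer[OF lf(1,4), of x] layer[OF lf(2,3), of x]
        layer[OF lf(2,4), of x] unfolding hdefs by auto
    have h_eq: "convolution f g x = h0 x + (h01 x + h10 x) + h2 x" for x
    proof -
      let ?A = "unit_box a (insert j S)"
      have sup: "supported_in f0 ?A" "supported_in f1 ?A"
        using insert.prems(1) by (auto simp: defs supported_in_def)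
      note conv = convolution_eq_sum[OF finite_unit_box]
      show ?thesis
        unfolding hdefs conv[OF insert.prems(1)] conv[OF sup(1)] conv[OF sup(2)]
        unfolding sum.distrib[symmetric]
        by (rule sum.cong) (auto simp: f_eq g_eq algebra_simps)
    qed
    have pointwise: "\<bar>convolution f g x\<bar> powr r
        = \<bar>h0 x\<bar> powr r + \<bar>h01 x + h10 x\<bar> powr r + \<bar>h2 x\<bar> powr r" for x
      using lh[of x] h_eq[of x] r0 by
        (cases "x $ j = a $ j + b $ j"; cases "x $ j = a $ j + b $ j + 1") auto
    \<comment> \<open>A finite set that supports all the convolutions, so that norms are sums over it.\<close>
    define C where "C = (\<lambda>(x, y). x + y) ` (unit_box a (insert j S) \<times> unit_box b (insert j S))"
    have finC: "finite C" unfolding C_def by (intro finite_imageI finite_cartesian_product finite_unit_box)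
    have sC: "supported_in (convolution u v) C"
      if "\<forall>x. f x = 0 \<longrightarrow> u x = 0" "\<forall>x. g x = 0 \<longrightarrow> v x = 0" for u v
      unfolding C_def using that insert.prems
      by (intro supported_in_convolution) (auto simp: supported_in_def)
    have "supported_in h0 C" "supported_in h01 C" "supported_in h10 C" "supported_in h2 C"
      "supported_in (convolution f g) C"
      unfolding hdefs by (rule sC; simp add: defs)+
    note sums = this[THEN lp_norm_powr_eq_sum[OF finC _ r0]]
    define F0 where "F0 = lp_norm p f0"
    define F1 where "F1 = lp_norm p f1"
    define G0 where "G0 = lp_norm p g0"
    define G1 where "G1 = lp_norm p g1"
    have nn: "0 \<le> F0" "0 \<le> F1" "0 \<le> G0" "0 \<le> G1"
      by (simp_all add: F0_def F1_def G0_def G1_def lp_norm_nonneg)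
    have ih: "lp_norm r h0 \<le> F0 * G0" "lp_norm r h01 \<le> F0 * G1"
      "lp_norm r h10 \<le> F1 * G0" "lp_norm r h2 \<le> F1 * G1"
      unfolding hdefs F0_def F1_def G0_def G1_def
      by (rule insert.IH; fact sf0 sf1 sg0 sg1)+
    have "lp_norm r (convolution f g) powr r
        = lp_norm r h0 powr r + (\<Sum>x\<in>C. \<bar>h01 x + h10 x\<bar> powr r) + lp_norm r h2 powr r"
      unfolding sums pointwise sum.distrib ..
    also have "\<dots> \<le> lp_norm r h0 powr r + (lp_norm r h01 + lp_norm r h10) powr r + lp_norm r h2 powr r"
      using Minkowski_sum_powr[OF finC r lp_norm_nonneg lp_norm_nonneg sums(2,3)[symmetric]] by simp
    also have "\<dots> \<le> (F0 * G0) powr r + (F0 * G1 + F1 * G0) powr r + (F1 * G1) powr r"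
      using ih r0 by (intro add_mono powr_mono2) (auto simp: lp_norm_nonneg)
    also have "\<dots> \<le> (F0 powr p + F1 powr p) powr (r / p) * (G0 powr p + G1 powr p) powr (r / p)"
      unfolding p_def using two_point_inequality[OF r nn] by simp
    also have "F0 powr p + F1 powr p = lp_norm p f powr p"
    proof -
      have "supported_in f0 (unit_box a (insert j S))" "supported_in f1 (unit_box a (insert j S))"
        using insert.prems(1) by (auto simp: defs supported_in_def)
      note * = this[THEN lp_norm_powr_eq_sum[OF finite_unit_box _ p0]]
        lp_norm_powr_eq_sum[OF finite_unit_box insert.prems(1) p0]
      show ?thesis unfolding F0_def F1_def * sum.distrib[symmetric]
        by (rule sum.cong) (auto simp: f_eq, auto simp: defs)
    qed
    also have "G0 powr p + G1 powr p = lp_norm p g powr p"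
    proof -
      have "supported_in g0 (unit_box b (insert j S))" "supported_in g1 (unit_box b (insert j S))"
        using insert.prems(2) by (auto simp: defs supported_in_def)
      note * = this[THEN lp_norm_powr_eq_sum[OF finite_unit_box _ p0]]
        lp_norm_powr_eq_sum[OF finite_unit_box insert.prems(2) p0]
      show ?thesis unfolding G0_def G1_def * sum.distrib[symmetric]
        by (rule sum.cong) (auto simp: g_eq, auto simp: defs)
    qed
    finally have "lp_norm r (convolution f g) powr r \<le> (lp_norm p f * lp_norm p g) powr r"
      using p0 by (simp add: powr_powr powr_mult)
    then show ?case
      using r0 powr_less_mono2[of r "lp_norm p f * lp_norm p g" "lp_norm r (convolution f g)"]
      by (force simp: lp_norm_nonneg)
  qed
  then show ?thesis unfolding p_def .
qed

section \<open>Optimality of the exponent, and the sharp inequality\<close>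

lemma convolution_segment_not_le:
  fixes r p :: real and j :: "'d::finite"
  assumes r: "1 \<le> r" and p: "crit_exponent r < p"
  defines "f \<equiv> indicat_real {0, axis j 1 :: int ^ 'd}"
  shows "\<not> lp_norm r (convolution f f) \<le> lp_norm p f * lp_norm p f"
proof
  let ?e = "axis j 1 :: int ^ 'd"
  define P where "P = crit_exponent r"
  note b = crit_exponent_bounds[OF r, folded P_def]
  have pos: "0 < P" "0 < p" "0 < r" using b p r unfolding P_def by auto
  have e: "?e \<noteq> 0" "?e + ?e \<noteq> 0" "?e + ?e \<noteq> ?e" by (auto simp: vec_eq_iff axis_def)
  have sf: "supported_in f {0, ?e}" by (auto simp: f_def supported_in_def)
  have conv: "convolution f f x = f x + f (x - ?e)" for x
    using convolution_eq_sum[OF _ sf, of f x] e by (simp add: f_def)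
  have vals: "convolution f f 0 = 1" "convolution f f ?e = 2" "convolution f f (?e + ?e) = 1"
    unfolding conv using e by (auto simp: f_def indicator_def)
  have "supported_in (convolution f f) {0, ?e, ?e + ?e}"
    using supported_in_convolution[OF sf sf] by (auto simp: supported_in_def)
  then have "lp_norm r (convolution f f) powr r
      = (\<Sum>x\<in>{0, ?e, ?e + ?e}. \<bar>convolution f f x\<bar> powr r)"
    by (intro lp_norm_powr_eq_sum) (use pos in auto)
  also have "\<dots> = 2 + 2 powr r" using e vals(3) by (simp add: vals(1,2))
  finally have h: "lp_norm r (convolution f f) powr r = 2 powr (2 * r / P)" using b by simp
  have "lp_norm p f powr p = (\<Sum>x\<in>{0, ?e}. \<bar>f x\<bar> powr p)"
    using sf pos by (intro lp_norm_powr_eq_sum) auto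
  also have "\<dots> = 2" using e by (simp add: f_def)
  finally have "(lp_norm p f powr p) powr (1 / p) = 2 powr (1 / p)" by simp
  then have nf: "lp_norm p f = 2 powr (1 / p)"
    using pos by (simp add: powr_powr lp_norm_nonneg)
  assume "lp_norm r (convolution f f) \<le> lp_norm p f * lp_norm p f"
  also have "\<dots> = 2 powr (2 / p)" unfolding nf by (simp flip: powr_add)
  finally have "lp_norm r (convolution f f) powr r \<le> (2 powr (2 / p)) powr r"
    using pos by (intro powr_mono2) (auto simp: lp_norm_nonneg)
  then have "2 powr (2 * r / P) \<le> (2::real) powr (2 * r / p)" unfolding h by (simp add: powr_powr)
  then have "2 * r / P \<le> 2 * r / p" by simp
  then show False using pos p by (simp add: P_def field_simps)
qed

theorem theorem1p1:
  fixes r :: real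
  assumes "r \<ge> 1"
  shows "(\<forall>f g :: int ^ 'd \<Rightarrow> real.
            supported_in f cube01 \<longrightarrow> supported_in g cube01 \<longrightarrow>
            lp_norm r (convolution f g)
              \<le> lp_norm (crit_exponent r) f * lp_norm (crit_exponent r) g)
       \<and> (\<forall>p > crit_exponent r. \<exists>f g :: int ^ 'd \<Rightarrow> real.
            supported_in f cube01 \<and> supported_in g cube01 \<and>
            \<not> lp_norm r (convolution f g) \<le> lp_norm p f * lp_norm p g)"
proof (intro conjI allI impI)
  fix f g :: "int ^ 'd \<Rightarrow> real"
  assume "supported_in f cube01" "supported_in g cube01"
  then show "lp_norm r (convolution f g) \<le> lp_norm (crit_exponent r) f * lp_norm (crit_exponent r) g"
    unfolding cube01_eq_unit_box by (rule convolution_lp_norm_le_unit_box[OF assms])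
next
  fix p assume p: "crit_exponent r < p"
  \<comment> \<open>Any coordinate direction serves, and \<open>undefined\<close> picks one.\<close>
  let ?f = "indicat_real {0, axis undefined 1 :: int ^ 'd}"
  have "supported_in ?f cube01"
    by (auto simp: supported_in_def cube01_def axis_def indicator_def)
  then show "\<exists>f g :: int ^ 'd \<Rightarrow> real. supported_in f cube01 \<and> supported_in g cube01 \<and>
      \<not> lp_norm r (convolution f g) \<le> lp_norm p f * lp_norm p g"
    using convolution_segment_not_le[OF assms p] by blast
qed

end
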